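(* Let $\mathcal{H}$ be a Hilbert space and $\mathcal{H}_O\subsetneq\mathcal{H}$ a closed strict subspace with the induced inner product. Let $P_t=\exp(t\mathsf{L})$ be a hypocoercive contraction $C_0$-semigroup on $\mathcal{H}$ satisfying $\|P_tx-P_\infty x\|_{\mathcal{H}}\le Ce^{-\nu t}\|x-P_\infty x\|_{\mathcal{H}}$ for all $x\in\mathcal{H}$, $t\ge0$, and let $P_{t,O}=\exp(t\mathsf{L}_O)$ be a symmetric contraction $C_0$-semigroup on $\mathcal{H}_O$ that is coercive with spectral gap $\lambda_O>0$ and whose generator has purely discrete spectrum. Suppose that $P_t$ is a second-order lift of $P_{t,O}$ (in the sense defined in the context, with operator $\mathsf{S}$), and that the constant $$\tilde s_{\rm m}:=\inf_{x\in\overline{\mathrm{Ran}(\mathsf{L}|_{\mathcal{H}_O})}\setminus\{0\}}\frac{\|\Pi_1\mathsf{S}\Pi_1x\|_{\mathcal{H}}}{\|x\|_{\mathcal{H}}}$$ is positive, where $\Pi_1$ is the orthogonal projection from $\mathcal{H}_O^\perp$ onto $\overline{\mathrm{Ran}(\mathsf{L}|_{\mathcal{H}_O})}$. Then $$\nu\le(1+\log C)\sqrt{\tilde s_{\rm m}^{-1}\lambda_O}.$$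
   Context: A contraction $C_0$-semigroup $P_t$ is a strongly continuous semigroup with $\|P_t\|\le1$; $\mathsf{L}$, with domain $\mathrm{Dom}(\mathsf{L})$, is its generator. $\mathcal{F}=\ker(\mathsf{L})$ is the equilibrium subspace and $P_\infty$ the orthogonal projection of $\mathcal{H}$ onto $\mathcal{F}$. $P_t$ is called hypocoercive if the estimate $\|P_tx-P_\infty x\|\le Ce^{-\nu t}\|x-P_\infty x\|$ holds for some $C>1$, $\nu>0$. $\mathsf{L}|_{\mathcal{H}_O}$ is the restriction of $\mathsf{L}$ to $\mathrm{Dom}(\mathsf{L})\cap\mathcal{H}_O$. Coercivity of $P_{t,O}$: $\mathsf{L}_O$ is negative self-adjoint on $\mathcal{H}_O$ and $\|P_{t,O}x\|_{\mathcal{H}_O}\le e^{-\lambda_Ot}\|x\|_{\mathcal{H}_O}$ for $x\in\ker(\mathsf{L}_O)^{\perp_{\mathcal{H}_O}}$ (orthogonal complement within $\mathcal{H}_O$), with optimal rate $\lambda_O=\inf\{-\langle x,\mathsf{L}_Ox\rangle:\ x\in\mathrm{Dom}(\mathsf{L}_O)\cap\ker(\mathsf{L}_O)^{\perp_{\mathcal{H}_O}},\ \|x\|=1\}>0$. Second-order lift: $P_t$ is a second-order lift of $P_{t,O}$ if (i) $\mathrm{Dom}(\mathsf{L}_O)\subset\mathrm{Dom}(\mathsf{L})$; (ii) $\langle x,\mathsf{L}y\rangle_{\mathcal{H}}=0$ for all $x\in\mathcal{H}_O$, $y\in\mathrm{Dom}(\mathsf{L})\cap\mathcal{H}_O$;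 (iii) there is a positive bounded operator $\mathsf{S}:\mathcal{H}_O^\perp\to\mathcal{H}_O^\perp$ with $\langle\mathsf{L}x,\mathsf{S}\mathsf{L}y\rangle_{\mathcal{H}}=-\langle x,\mathsf{L}_Oy\rangle_{\mathcal{H}_O}$ for all $x\in\mathrm{Dom}(\mathsf{L})\cap\mathcal{H}_O$, $y\in\mathrm{Dom}(\mathsf{L}_O)$. (By (ii), $\mathsf{L}$ maps $\mathrm{Dom}(\mathsf{L})\cap\mathcal{H}_O$ into $\mathcal{H}_O^\perp$.)
   Formalization: Added hypothesis: P_∞ maps H_O into H_O (e.g. ker L ⊂ H_O). Without it the claim is false: on R^3 with H_O=span(e1), S=I, L_O=-1, there are lifts with λ_O=s̃_m=1, C=√3 and arbitrarily large ν. *)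

theory Defs
  imports "HOL-Analysis.Analysis"
begin

text \<open>
  The scalars are \<open>\<real>\<close> or \<open>\<complex>\<close>: every real normed field with a real part and a conjugation
  satisfying these axioms is isomorphic to one of the two, since each element is a root of a real
  polynomial of degree 2.
\<close>

class real_or_complex = real_normed_field +
  fixes re_part :: "'a \<Rightarrow> real"
    and conj_of :: "'a \<Rightarrow> 'a"
  assumes conj_of_add: "conj_of (x + y) = conj_of x + conj_of y"
    and conj_of_mult: "conj_of (x * y) = conj_of x * conj_of y"
    and conj_of_conj_of: "conj_of (conj_of x) = x"
    and add_conj_of: "x + conj_of x = (2 * re_part x) *\<^sub>R 1"
    and mult_conj_of: "x * conj_of x = (norm x)\<^sup>2 *\<^sub>R 1"

instantiation real :: real_or_complex
begin
definition re_part_real :: "real \<Rightarrow> real" where "re_part_real x = x"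
definition conj_of_real :: "real \<Rightarrow> real" where "conj_of_real x = x"
instance
  by standard (auto simp: re_part_real_def conj_of_real_def power2_eq_square)
end

instantiation complex :: real_or_complex
begin
definition re_part_complex :: "complex \<Rightarrow> real" where "re_part_complex = Re"
definition conj_of_complex :: "complex \<Rightarrow> complex" where "conj_of_complex = cnj"
instance
proof
  fix x y :: complex
  show "conj_of (x + y) = conj_of x + conj_of y" "conj_of (x * y) = conj_of x * conj_of y"
    "conj_of (conj_of x) = x"
    by (simp_all add: conj_of_complex_def)
  show "x + conj_of x = (2 * re_part x) *\<^sub>R 1"
    by (simp add: conj_of_complex_def re_part_complex_def complex_add_cnj scaleR_conv_of_real)
  show "x * conj_of x = (norm x)\<^sup>2 *\<^sub>R 1"
    unfolding conj_of_complex_def by (simp only: complex_norm_square[symmetric] scaleR_conv_of_real mult_1_right)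
qed
end

text \<open>
  A Hilbert space over the scalars \<^typ>\<open>'k\<close>. The type class \<^class>\<open>real_inner\<close> provides the
  norm, the topology and the underlying real structure; by polarization its real inner product is
  the real part of \<open>ip\<close>, so it carries no additional information. The inner product is linear in
  the second argument.
\<close>

locale hilbert_space = vector_space scl
  for scl :: "'k::real_or_complex \<Rightarrow> 'h::{real_inner, complete_space} \<Rightarrow> 'h" +
  fixes ip :: "'h \<Rightarrow> 'h \<Rightarrow> 'k"
  assumes scale_of_real: "scl (of_real r) x = r *\<^sub>R x"
    and ip_add_right: "ip x (y + z) = ip x y + ip x z"
    and ip_scale_right: "ip x (scl c y) = c * ip x y"
    and ip_commute: "ip y x = conj_of (ip x y)"
    and ip_self: "ip x x = of_real ((norm x)\<^sup>2)"

lemma hilbert_space_real: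
  "hilbert_space (scaleR :: real \<Rightarrow> 'h::{real_inner, complete_space} \<Rightarrow> 'h) inner"
proof (intro hilbert_space.intro hilbert_space_axioms.intro)
  show "vector_space (scaleR :: real \<Rightarrow> 'h \<Rightarrow> 'h)"
    by (rule real_vector.vector_space_axioms)
  show "inner y x = conj_of (inner x y)" for x y :: 'h
    unfolding conj_of_real_def by (rule inner_commute)
qed (simp_all add: inner_add_right dot_square_norm)

lemma hilbert_space_complex:
  "hilbert_space ((*) :: complex \<Rightarrow> complex \<Rightarrow> complex) (\<lambda>x y. cnj x * y)"
proof (intro hilbert_space.intro hilbert_space_axioms.intro)
  show "vector_space ((*) :: complex \<Rightarrow> complex \<Rightarrow> complex)"
    by (rule vector_space_over_itself.vector_space_axioms)
  show "cnj x * x = of_real ((norm x)\<^sup>2)" for x :: complex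
    by (metis complex_norm_square mult.commute)
qed (simp_all add: distrib_left conj_of_complex_def scaleR_conv_of_real)

text \<open>
  Below, \<open>V\<close> is the carrier (\<open>UNIV\<close> or a closed subspace) of the space on which an
  operator or semigroup acts; values outside the carrier or the domain are irrelevant.
\<close>

definition ortho_compl :: "('h \<Rightarrow> 'h \<Rightarrow> 'k::real_or_complex) \<Rightarrow> 'h set \<Rightarrow> 'h set \<Rightarrow> 'h set" where
  "ortho_compl ip V A = {x \<in> V. \<forall>y\<in>A. ip y x = 0}"

definition ortho_proj ::
  "('h::ab_group_add \<Rightarrow> 'h \<Rightarrow> 'k::real_or_complex) \<Rightarrow> 'h set \<Rightarrow> 'h \<Rightarrow> 'h" where
  "ortho_proj ip W x = (THE p. p \<in> W \<and> (\<forall>w\<in>W. ip w (x - p) = 0))"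

definition bounded_op_on ::
  "('k::real_or_complex \<Rightarrow> 'h::real_normed_vector \<Rightarrow> 'h) \<Rightarrow> 'h set \<Rightarrow> ('h \<Rightarrow> 'h) \<Rightarrow> bool" where
  "bounded_op_on scl V T \<longleftrightarrow>
     T ` V \<subseteq> V \<and>
     (\<forall>x\<in>V. \<forall>y\<in>V. T (x + y) = T x + T y) \<and>
     (\<forall>c. \<forall>x\<in>V. T (scl c x) = scl c (T x)) \<and>
     (\<exists>M. \<forall>x\<in>V. norm (T x) \<le> M * norm x)"

text \<open>
  Over \<open>\<complex>\<close> the symmetry follows from the sign condition; over \<open>\<real>\<close> it is part of
  the usual meaning of a positive operator.
\<close>

definition positive_op_on ::
  "('h \<Rightarrow> 'h \<Rightarrow> 'k::real_or_complex) \<Rightarrow> 'h set \<Rightarrow> ('h \<Rightarrow> 'h) \<Rightarrow> bool" where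
  "positive_op_on ip V T \<longleftrightarrow>
     (\<forall>x\<in>V. \<forall>y\<in>V. ip (T x) y = ip x (T y)) \<and>
     (\<forall>x\<in>V. 0 \<le> re_part (ip x (T x)))"

definition contraction_C0_semigroup ::
  "('k::real_or_complex \<Rightarrow> 'h::real_normed_vector \<Rightarrow> 'h) \<Rightarrow> 'h set \<Rightarrow> (real \<Rightarrow> 'h \<Rightarrow> 'h) \<Rightarrow> bool" where
  "contraction_C0_semigroup scl V P \<longleftrightarrow>
     (\<forall>t\<ge>0. bounded_op_on scl V (P t)) \<and>
     (\<forall>x\<in>V. P 0 x = x) \<and>
     (\<forall>s\<ge>0. \<forall>t\<ge>0. \<forall>x\<in>V. P (s + t) x = P s (P t x)) \<and>
     (\<forall>x\<in>V. ((\<lambda>t. P t x) \<longlongrightarrow> x) (at_right 0)) \<and>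
     (\<forall>t\<ge>0. \<forall>x\<in>V. norm (P t x) \<le> norm x)"

definition gen_dom :: "'h::real_normed_vector set \<Rightarrow> (real \<Rightarrow> 'h \<Rightarrow> 'h) \<Rightarrow> 'h set" where
  "gen_dom V P = {x \<in> V. \<exists>y. ((\<lambda>t. (P t x - x) /\<^sub>R t) \<longlongrightarrow> y) (at_right 0)}"

definition generator :: "(real \<Rightarrow> 'h::real_normed_vector \<Rightarrow> 'h) \<Rightarrow> 'h \<Rightarrow> 'h" where
  "generator P x = Lim (at_right 0) (\<lambda>t. (P t x - x) /\<^sub>R t)"

definition gen_ker :: "'h::real_normed_vector set \<Rightarrow> (real \<Rightarrow> 'h \<Rightarrow> 'h) \<Rightarrow> 'h set" where
  "gen_ker V P = {x \<in> gen_dom V P. generator P x = 0}"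

definition equilibrium_proj ::
  "('h::real_normed_vector \<Rightarrow> 'h \<Rightarrow> 'k::real_or_complex) \<Rightarrow> (real \<Rightarrow> 'h \<Rightarrow> 'h) \<Rightarrow> 'h \<Rightarrow> 'h" where
  "equilibrium_proj ip P = ortho_proj ip (gen_ker UNIV P)"

definition hypocoercive ::
  "('h::real_normed_vector \<Rightarrow> 'h \<Rightarrow> 'k::real_or_complex) \<Rightarrow> (real \<Rightarrow> 'h \<Rightarrow> 'h) \<Rightarrow>
    real \<Rightarrow> real \<Rightarrow> bool" where
  "hypocoercive ip P C \<nu> \<longleftrightarrow> C > 1 \<and> \<nu> > 0 \<and>
     (\<forall>x. \<forall>t\<ge>0. norm (P t x - equilibrium_proj ip P x)
        \<le> C * exp (- \<nu> * t) * norm (x - equilibrium_proj ip P x))"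

definition symmetric_semigroup ::
  "('h \<Rightarrow> 'h \<Rightarrow> 'k::real_or_complex) \<Rightarrow> 'h set \<Rightarrow> (real \<Rightarrow> 'h \<Rightarrow> 'h) \<Rightarrow> bool" where
  "symmetric_semigroup ip V P \<longleftrightarrow> (\<forall>t\<ge>0. \<forall>x\<in>V. \<forall>y\<in>V. ip (P t x) y = ip x (P t y))"

definition adjoint_graph ::
  "('h \<Rightarrow> 'h \<Rightarrow> 'k::real_or_complex) \<Rightarrow> 'h set \<Rightarrow> 'h set \<Rightarrow> ('h \<Rightarrow> 'h) \<Rightarrow> ('h \<times> 'h) set" where
  "adjoint_graph ip V D A = {(y, z). y \<in> V \<and> z \<in> V \<and> (\<forall>x\<in>D. ip (A x) y = ip x z)}"

definition self_adjoint_on ::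
  "('h::real_normed_vector \<Rightarrow> 'h \<Rightarrow> 'k::real_or_complex) \<Rightarrow> 'h set \<Rightarrow> 'h set \<Rightarrow> ('h \<Rightarrow> 'h) \<Rightarrow> bool" where
  "self_adjoint_on ip V D A \<longleftrightarrow>
     D \<subseteq> V \<and> V \<subseteq> closure D \<and> adjoint_graph ip V D A = {(x, A x) |x. x \<in> D}"

text \<open>
  The infimum is taken in the extended reals, so that equality with the real number
  \<open>lam\<close> includes that the set is nonempty, that is, that the generator is not zero.
\<close>

definition coercive_semigroup ::
  "('h::real_normed_vector \<Rightarrow> 'h \<Rightarrow> 'k::real_or_complex) \<Rightarrow> 'h set \<Rightarrow> (real \<Rightarrow> 'h \<Rightarrow> 'h) \<Rightarrow>
    real \<Rightarrow> bool" where
  "coercive_semigroup ip V P lam \<longleftrightarrow>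
     self_adjoint_on ip V (gen_dom V P) (generator P) \<and>
     (\<forall>x\<in>gen_dom V P. re_part (ip x (generator P x)) \<le> 0) \<and>
     (\<forall>x\<in>ortho_compl ip V (gen_ker V P). \<forall>t\<ge>0. norm (P t x) \<le> exp (- lam * t) * norm x) \<and>
     ereal lam = (INF x\<in>{x \<in> gen_dom V P \<inter> ortho_compl ip V (gen_ker V P). norm x = 1}.
        ereal (- re_part (ip x (generator P x)))) \<and>
     lam > 0"

definition spectrum_on ::
  "('k::real_or_complex \<Rightarrow> 'h::real_normed_vector \<Rightarrow> 'h) \<Rightarrow> 'h set \<Rightarrow> 'h set \<Rightarrow> ('h \<Rightarrow> 'h) \<Rightarrow> 'k set" where
  "spectrum_on scl V D A =
     {\<mu>. \<not> (bij_betw (\<lambda>x. A x - scl \<mu> x) D V \<and>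
            (\<exists>M. \<forall>x\<in>D. norm x \<le> M * norm (A x - scl \<mu> x)))}"

text \<open>
  All spectral points are isolated eigenvalues of finite multiplicity. This is used for
  self-adjoint operators, whose spectrum is real (so that real scalars suffice over a real space)
  and for which geometric and algebraic multiplicity agree.
\<close>

definition purely_discrete_spectrum ::
  "('k::real_or_complex \<Rightarrow> 'h::real_normed_vector \<Rightarrow> 'h) \<Rightarrow> 'h set \<Rightarrow> 'h set \<Rightarrow> ('h \<Rightarrow> 'h) \<Rightarrow> bool" where
  "purely_discrete_spectrum scl V D A \<longleftrightarrow>
     (\<forall>\<mu>\<in>spectrum_on scl V D A.
        \<not> \<mu> islimpt spectrum_on scl V D A \<and>
        (\<exists>x\<in>D. x \<noteq> 0 \<and> A x = scl \<mu> x) \<and>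
        (\<exists>B. finite B \<and> {x \<in> D. A x = scl \<mu> x} \<subseteq> module.span scl B))"

definition second_order_lift ::
  "('k::real_or_complex \<Rightarrow> 'h::real_normed_vector \<Rightarrow> 'h) \<Rightarrow> ('h \<Rightarrow> 'h \<Rightarrow> 'k) \<Rightarrow> 'h set \<Rightarrow>
    (real \<Rightarrow> 'h \<Rightarrow> 'h) \<Rightarrow> (real \<Rightarrow> 'h \<Rightarrow> 'h) \<Rightarrow> ('h \<Rightarrow> 'h) \<Rightarrow> bool" where
  "second_order_lift scl ip HO P PO S \<longleftrightarrow>
     gen_dom HO PO \<subseteq> gen_dom UNIV P \<and>
     (\<forall>x\<in>HO. \<forall>y\<in>gen_dom UNIV P \<inter> HO. ip x (generator P y) = 0) \<and>
     bounded_op_on scl (ortho_compl ip UNIV HO) S \<and>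
     positive_op_on ip (ortho_compl ip UNIV HO) S \<and>
     (\<forall>x\<in>gen_dom UNIV P \<inter> HO. \<forall>y\<in>gen_dom HO PO.
        ip (generator P x) (S (generator P y)) = - ip x (generator PO y))"

definition ran_closure :: "'h::real_normed_vector set \<Rightarrow> (real \<Rightarrow> 'h \<Rightarrow> 'h) \<Rightarrow> 'h set" where
  "ran_closure HO P = closure (generator P ` (gen_dom UNIV P \<inter> HO))"

text \<open>
  This is an infimum of real numbers. The set is nonempty whenever \<open>P\<close> is a second-order
  lift of a coercive semigroup, since then \<open>generator P\<close> does not vanish on
  \<open>gen_dom HO PO\<close>.
\<close>

definition lift_const ::
  "('h::real_normed_vector \<Rightarrow> 'h \<Rightarrow> 'k::real_or_complex) \<Rightarrow> 'h set \<Rightarrow> (real \<Rightarrow> 'h \<Rightarrow> 'h) \<Rightarrow>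
    ('h \<Rightarrow> 'h) \<Rightarrow> real" where
  "lift_const ip HO P S =
     (INF x\<in>ran_closure HO P - {0}.
        norm (ortho_proj ip (ran_closure HO P) (S (ortho_proj ip (ran_closure HO P) x))) / norm x)"

text \<open>
  A second-order lift in the sense above need not respect the equilibria: for
  \<open>r\<^sup>2 = 1 + d\<^sup>2\<close>, the matrix with rows \<open>(0, -1, 0)\<close>,
  \<open>(1, -r, -d)\<close>, \<open>(0, d, 0)\<close> generates a contraction semigroup on
  \<open>\<real>\<^sup>3\<close> that is a second-order lift, with \<open>S\<close> the identity, of
  \<open>exp (-t)\<close> on the first coordinate axis. Both \<open>lam\<close> and \<open>lift_const\<close>
  are 1, and the semigroup is hypocoercive with \<open>C = sqrt 3\<close> and \<open>\<nu> = r / 2\<close>, for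
  every \<open>d\<close>. Bounds on \<open>\<nu>\<close> therefore require in addition that the equilibrium
  projection leaves \<open>HO\<close> invariant, as it does if \<open>gen_ker UNIV P \<subseteq> HO\<close>. In the
  example the kernel is spanned by \<open>(d, 0, 1)\<close>.
\<close>

definition equilibrium_compatible ::
  "('h::real_normed_vector \<Rightarrow> 'h \<Rightarrow> 'k::real_or_complex) \<Rightarrow> 'h set \<Rightarrow> (real \<Rightarrow> 'h \<Rightarrow> 'h) \<Rightarrow> bool" where
  "equilibrium_compatible ip HO P \<longleftrightarrow> equilibrium_proj ip P ` HO \<subseteq> HO"

end

theory Submission
  imports Defs
begin

text \<open>
  Write \<open>Q\<close> for the equilibrium projection and \<open>s\<close> for the lift constant. Two bounds on
  \<open>norm (generator P x)\<close>, for a suitable unit vector \<open>x\<close> of \<open>HO\<close>, are played off against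
  each other.

  From below, hypocoercivity makes the generator boundedly invertible off the equilibria: if
  \<open>Q x = 0\<close>, then \<open>x\<close> is minus the integral of \<open>P t (generator P x)\<close> over all times, and the
  integrand has norm at most \<open>min 1 (C * exp (- \<nu> * t)) * norm (generator P x)\<close>. That minimum has
  integral \<open>(1 + ln C) / \<nu>\<close>, so \<open>\<nu> * norm x \<le> (1 + ln C) * norm (generator P x)\<close>
  (\<open>norm_le_norm_generator\<close>).

  From above, the lift identity turns the Dirichlet form of \<open>PO\<close> into the form of \<open>S\<close> at
  \<open>generator P x\<close>. A positive symmetric operator that expands every norm by at least the factor \<open>s\<close>
  has a form of size at least \<open>s\<close> (\<open>symmetric_bounded_below_imp_coercive\<close>), so that
  \<open>s * (norm (generator P x))\<^sup>2\<close> is bounded by the Dirichlet form (\<open>lift_const_le_form\<close>).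

  The vector \<open>x\<close> is taken in \<open>gen_dom HO PO\<close>, orthogonal to the kernel of the generator of \<open>PO\<close>,
  with Dirichlet form close to the gap \<open>lamO\<close>. The condition \<open>Q x = 0\<close> in the first bound holds
  because \<open>Q x\<close> lies in \<open>HO\<close>, where the lift identity and self-adjointness identify equilibria
  of \<open>P\<close> as equilibria of \<open>PO\<close>, to which \<open>x\<close> is orthogonal
  (\<open>equilibrium_proj_eq_0_of_lift\<close>). Near-minimisers are enough, since the final estimate
  depends continuously on the Dirichlet form.
\<close>

section \<open>Orthogonal projections and positive operators\<close>

text \<open>
  The Hilbert space projection theorem: by the parallelogram law, a sequence in \<open>W\<close> whose
  distances to \<open>v\<close> tend to the minimum is Cauchy, and its limit is the foot of the perpendicular.
\<close>
lemma hilbert_projection: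
  fixes W :: "'h::{real_inner, complete_space} set"
  assumes "subspace W" and "closed W"
  shows "\<exists>p\<in>W. \<forall>w\<in>W. inner w (v - p) = 0"
proof -
  define d where "d = (INF w\<in>W. (norm (v - w))\<^sup>2)"
  have W0: "0 \<in> W" using assms(1) by (rule subspace_0)
  have bdd: "bdd_below ((\<lambda>w. (norm (v - w))\<^sup>2) ` W)"
    by (rule bdd_belowI[of _ 0]) auto
  have d_le: "d \<le> (norm (v - w))\<^sup>2" if "w \<in> W" for w
    unfolding d_def by (rule cINF_lower[OF bdd that])
  have "\<exists>w\<in>W. (norm (v - w))\<^sup>2 < d + inverse (real (Suc n))" for n
  proof -
    have "(INF w\<in>W. (norm (v - w))\<^sup>2) < d + inverse (real (Suc n))"
      by (simp add: d_def)
    then show ?thesis using cINF_less_iff[OF _ bdd] W0 by blast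
  qed
  then obtain u where uW: "u n \<in> W" and u: "(norm (v - u n))\<^sup>2 < d + inverse (real (Suc n))" for n
    by metis
  have gap: "(norm (u m - u n))\<^sup>2 \<le> 2 * inverse (real (Suc m)) + 2 * inverse (real (Suc n))" for m n
  proof -
    have mid: "(1/2) *\<^sub>R (u m + u n) \<in> W"
      using assms(1) uW by (intro subspace_scale subspace_add)
    have "(norm (u m - u n))\<^sup>2 = 2 * (norm (v - u m))\<^sup>2 + 2 * (norm (v - u n))\<^sup>2
        - 4 * (norm (v - (1/2) *\<^sub>R (u m + u n)))\<^sup>2"
      unfolding power2_norm_eq_inner
      by (simp add: inner_diff_left inner_diff_right inner_add_left inner_add_right inner_commute
          algebra_simps)
    then show ?thesis using d_le[OF mid] u[of m] u[of n] by linarith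
  qed
  have "Cauchy u"
  proof (rule metric_CauchyI)
    fix e :: real assume e: "0 < e"
    then obtain N where N: "inverse (real (Suc N)) < e\<^sup>2 / 4"
      using reals_Archimedean[of "e\<^sup>2 / 4"] by auto
    have "dist (u m) (u n) < e" if "m \<ge> N" "n \<ge> N" for m n
    proof -
      have "inverse (real (Suc m)) \<le> inverse (real (Suc N))"
        "inverse (real (Suc n)) \<le> inverse (real (Suc N))"
        using that by (auto intro!: le_imp_inverse_le)
      then have "(norm (u m - u n))\<^sup>2 < e\<^sup>2" using gap[of m n] N by linarith
      then show ?thesis using e by (simp add: dist_norm power2_less_imp_less)
    qed
    then show "\<exists>N. \<forall>m\<ge>N. \<forall>n\<ge>N. dist (u m) (u n) < e" by blast
  qed
  then obtain p where p: "u \<longlonglongrightarrow> p" using Cauchy_convergent_iff convergent_def by blast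
  have pW: "p \<in> W" using closed_sequentially[OF assms(2) _ p] uW by blast
  have "(norm (v - p))\<^sup>2 \<le> d + 0"
  proof (rule LIMSEQ_le)
    show "(\<lambda>n. (norm (v - u n))\<^sup>2) \<longlonglongrightarrow> (norm (v - p))\<^sup>2" by (intro tendsto_intros p)
    show "(\<lambda>n. d + inverse (real (Suc n))) \<longlonglongrightarrow> d + 0"
      by (intro tendsto_intros LIMSEQ_inverse_real_of_nat)
    show "\<exists>N. \<forall>n\<ge>N. (norm (v - u n))\<^sup>2 \<le> d + inverse (real (Suc n))"
      using u less_imp_le by blast
  qed
  then have pd: "(norm (v - p))\<^sup>2 \<le> d" by simp
  have "inner w (v - p) = 0" if w: "w \<in> W" for w
  proof (cases "w = 0")
    case False
    \<comment> \<open>The point of the line through \<open>p\<close> in direction \<open>w\<close> closest to \<open>v\<close>.\<close>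
    define t where "t = inner w (v - p) / (norm w)\<^sup>2"
    have "p + t *\<^sub>R w \<in> W" using assms(1) pW w by (intro subspace_scale subspace_add)
    then have "(norm (v - p))\<^sup>2 \<le> (norm (v - (p + t *\<^sub>R w)))\<^sup>2" using d_le pd order_trans by blast
    also have "\<dots> = (norm (v - p))\<^sup>2 - 2 * t * inner w (v - p) + t\<^sup>2 * (norm w)\<^sup>2"
      unfolding power2_norm_eq_inner
      by (simp add: inner_diff_left inner_diff_right inner_add_left inner_add_right inner_commute
          algebra_simps power2_eq_square)
    also have "\<dots> = (norm (v - p))\<^sup>2 - (inner w (v - p))\<^sup>2 / (norm w)\<^sup>2"
      using False by (simp add: t_def power2_eq_square field_simps)
    finally have "(inner w (v - p))\<^sup>2 / (norm w)\<^sup>2 \<le> 0" by simp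
    then show ?thesis using False by (simp add: divide_le_0_iff)
  qed simp
  with pW show ?thesis by blast
qed

text \<open>
  The spectrum of a positive symmetric operator lies in the nonnegative reals, and its bottom
  \<open>m\<close>, the infimum of the Rayleigh quotient, is an approximate eigenvalue; hence an \<open>A\<close> that
  expands norms by at least the factor \<open>s\<close> has \<open>s \<le> m\<close>. The approximate eigenvectors come from the estimate
  \<open>residual\<close>, a Cauchy-Schwarz inequality for the positive form of \<open>A - m\<close>. Additivity of \<open>A\<close>
  enters only under the inner product with vectors of \<open>W\<close>, where symmetry supplies it.
\<close>
lemma symmetric_bounded_below_imp_coercive:
  fixes A :: "'h::real_inner \<Rightarrow> 'h"
  assumes W: "subspace W" and AW: "\<And>x. x \<in> W \<Longrightarrow> A x \<in> W"
    and sym: "\<And>x y. x \<in> W \<Longrightarrow> y \<in> W \<Longrightarrow> inner (A x) y = inner x (A y)"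
    and pos: "\<And>x. x \<in> W \<Longrightarrow> 0 \<le> inner x (A x)"
    and bound: "\<And>x. x \<in> W \<Longrightarrow> norm (A x) \<le> M * norm x"
    and below: "\<And>x. x \<in> W \<Longrightarrow> s * norm x \<le> norm (A x)"
    and x: "x \<in> W"
  shows "s * (norm x)\<^sup>2 \<le> inner x (A x)"
proof (cases "x = 0")
  case False
  \<comment> \<open>A bound that is safely positive, so that it can be divided by.\<close>
  define K where "K = max M 1"
  have K: "K > 0" and boundK: "norm (A y) \<le> K * norm y" if "y \<in> W" for y
    using bound[OF that] mult_right_mono[of M K "norm y"] by (auto simp: K_def)
  define m where "m = (INF y\<in>W - {0}. inner y (A y) / (norm y)\<^sup>2)"
  have ne: "W - {0} \<noteq> {}" using x False by blast
  have bdd: "bdd_below ((\<lambda>y. inner y (A y) / (norm y)\<^sup>2) ` (W - {0}))"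
    by (rule bdd_belowI[of _ 0]) (auto simp: pos)
  have m0: "0 \<le> m" unfolding m_def by (rule cINF_greatest[OF ne]) (auto simp: pos)
  have m_le: "m * (norm y)\<^sup>2 \<le> inner y (A y)" if "y \<in> W" for y
  proof (cases "y = 0")
    case False
    then have "m \<le> inner y (A y) / (norm y)\<^sup>2"
      unfolding m_def using that by (intro cINF_lower[OF bdd]) auto
    then show ?thesis using False by (simp add: pos_le_divide_eq)
  qed simp
  have residual: "(norm (A y - m *\<^sub>R y))\<^sup>2 \<le> K * (inner y (A y) - m * (norm y)\<^sup>2)" if y: "y \<in> W" for y
  proof -
    define z where "z = A y - m *\<^sub>R y"
    have z: "z \<in> W" unfolding z_def using W AW y by (intro subspace_diff subspace_scale)
    \<comment> \<open>Moving from \<open>y\<close> against the residual lowers the form of \<open>A - m\<close>; for this step length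
      the decrease is at least \<open>(norm z)\<^sup>2 / K\<close>, and the form must stay nonnegative.\<close>
    define t where "t = - inverse K"
    have yz: "y + t *\<^sub>R z \<in> W" using W y z by (intro subspace_add subspace_scale)
    have "inner (y + t *\<^sub>R z) (A (y + t *\<^sub>R z)) =
        inner (A (y + t *\<^sub>R z)) y + t * inner (A (y + t *\<^sub>R z)) z"
      by (simp add: inner_add_left inner_commute)
    also have "\<dots> = inner y (A y) + t * inner z (A y) + t * (inner y (A z) + t * inner z (A z))"
      using sym[OF yz y] sym[OF yz z] by (simp add: inner_add_left)
    also have "inner y (A z) = inner z (A y)" using sym[OF y z] by (simp add: inner_commute)
    finally have form: "inner (y + t *\<^sub>R z) (A (y + t *\<^sub>R z)) =
        inner y (A y) + 2 * t * inner z (A y) + t\<^sup>2 * inner z (A z)"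
      by (simp add: algebra_simps power2_eq_square)
    have sq: "(norm (y + t *\<^sub>R z))\<^sup>2 = (norm y)\<^sup>2 + 2 * t * inner z y + t\<^sup>2 * (norm z)\<^sup>2"
      unfolding power2_norm_eq_inner
      by (simp add: inner_add_left inner_add_right inner_commute algebra_simps power2_eq_square)
    have zz: "inner z (A y) - m * inner z y = (norm z)\<^sup>2"
      unfolding power2_norm_eq_inner by (simp add: z_def inner_diff_right)
    have "inner z (A z) \<le> norm z * norm (A z)" by (rule norm_cauchy_schwarz)
    also have "\<dots> \<le> norm z * (K * norm z)" by (intro mult_left_mono boundK z) simp
    finally have zAz: "inner z (A z) \<le> K * (norm z)\<^sup>2" by (simp add: power2_eq_square ac_simps)
    have "0 \<le> inner y (A y) - m * (norm y)\<^sup>2 + 2 * t * (inner z (A y) - m * inner z y)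
        + t\<^sup>2 * (inner z (A z) - m * (norm z)\<^sup>2)"
      using m_le[OF yz] unfolding form sq by (simp add: algebra_simps)
    also have "\<dots> \<le> inner y (A y) - m * (norm y)\<^sup>2 + 2 * t * (norm z)\<^sup>2 + t\<^sup>2 * (K * (norm z)\<^sup>2)"
    proof -
      have "0 \<le> m * (norm z)\<^sup>2" using m0 by simp
      then show ?thesis unfolding zz using zAz by (intro add_left_mono mult_left_mono) auto
    qed
    also have "\<dots> = inner y (A y) - m * (norm y)\<^sup>2 - (norm z)\<^sup>2 / K"
      using K[OF y] by (simp add: t_def field_simps power2_eq_square)
    finally show ?thesis using K[OF y] by (simp add: z_def field_simps)
  qed
  \<comment> \<open>At near-minimisers \<open>y\<close> of the Rayleigh quotient, \<open>A y\<close> is close to \<open>m *\<^sub>R y\<close>.\<close>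
  have "s \<le> m"
  proof (rule ccontr)
    assume "\<not> s \<le> m"
    then have "0 < s - m" by simp
    then have "m < m + (s - m)\<^sup>2 / K" using K[OF x] by simp
    then have "\<exists>y\<in>W - {0}. inner y (A y) / (norm y)\<^sup>2 < m + (s - m)\<^sup>2 / K"
      using cINF_less_iff[OF ne bdd, of "m + (s - m)\<^sup>2 / K"] by (simp only: flip: m_def)
    then obtain y where y: "y \<in> W" "y \<noteq> 0" and "inner y (A y) / (norm y)\<^sup>2 < m + (s - m)\<^sup>2 / K"
      by blast
    then have "inner y (A y) < (m + (s - m)\<^sup>2 / K) * (norm y)\<^sup>2" by (simp add: pos_divide_less_eq)
    then have "K * (inner y (A y) - m * (norm y)\<^sup>2) < (s - m)\<^sup>2 * (norm y)\<^sup>2"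
      using K[OF x] by (simp add: field_simps)
    then have "(norm (A y - m *\<^sub>R y))\<^sup>2 < ((s - m) * norm y)\<^sup>2"
      using residual[OF y(1)] by (simp add: power_mult_distrib)
    then have "norm (A y - m *\<^sub>R y) < (s - m) * norm y"
      using \<open>0 < s - m\<close> by (auto intro: power2_less_imp_less)
    moreover have "norm (A y) \<le> norm (A y - m *\<^sub>R y) + norm (m *\<^sub>R y)"
      using norm_triangle_ineq[of "A y - m *\<^sub>R y" "m *\<^sub>R y"] by simp
    ultimately show False using below[OF y(1)] m0 by (simp add: algebra_simps)
  qed
  then show ?thesis using m_le[OF x] mult_right_mono[of s m "(norm x)\<^sup>2"] by simp
qed simp

section \<open>Reduction to the real inner product\<close>

context hilbert_space
begin

lemma re_part_ip: "re_part (ip x y) = inner x y"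
proof -
  have ip_add_left: "ip (a + b) c = ip a c + ip b c" for a b c
    by (metis ip_commute ip_add_right conj_of_add)
  have "ip (x + y) (x + y) = ip x x + ip y y + (ip x y + conj_of (ip x y))"
    by (simp add: ip_add_left ip_add_right ip_commute[of y x] add_ac)
  then have "of_real ((norm (x + y))\<^sup>2) =
      (of_real ((norm x)\<^sup>2 + (norm y)\<^sup>2 + 2 * re_part (ip x y)) :: 'k)"
    by (simp add: ip_self add_conj_of scaleR_conv_of_real)
  then have "(norm (x + y))\<^sup>2 = (norm x)\<^sup>2 + (norm y)\<^sup>2 + 2 * re_part (ip x y)"
    by (simp only: of_real_eq_iff)
  then show ?thesis
    unfolding power2_norm_eq_inner
    by (simp add: inner_add_left inner_add_right inner_commute)
qed

lemma ip_scale_left: "ip (scl c x) y = conj_of c * ip x y"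
  by (metis ip_commute ip_scale_right conj_of_mult)

lemma conj_of_mult_self: "conj_of c * c = of_real ((norm c)\<^sup>2)" for c :: 'k
  using mult_conj_of[of c] by (simp add: mult.commute scaleR_conv_of_real)

lemma conj_of_zero: "conj_of 0 = (0::'k)"
  using conj_of_add[of "0::'k" 0] by simp

lemma re_part_of_real: "re_part (of_real r :: 'k) = r"
proof -
  have r: "conj_of (of_real r) = (of_real r :: 'k)"
  proof (cases "r = 0")
    case False
    have "of_real r * conj_of (of_real r :: 'k) = of_real r * of_real r"
      using mult_conj_of[of "of_real r :: 'k"]
      by (simp add: scaleR_conv_of_real power2_eq_square flip: of_real_mult)
    then show ?thesis using False by simp
  qed (simp add: conj_of_zero)
  have "of_real (2 * r) = (of_real (2 * re_part (of_real r :: 'k)) :: 'k)"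
    using add_conj_of[of "of_real r :: 'k"] unfolding r by (simp add: scaleR_conv_of_real)
  then show ?thesis by (simp only: of_real_eq_iff)
qed

lemma norm_scl: "norm (scl c x) = norm c * norm x"
proof -
  have "of_real ((norm (scl c x))\<^sup>2) = ip (scl c x) (scl c x)" by (simp only: ip_self)
  also have "\<dots> = (conj_of c * c) * ip x x"
    by (simp only: ip_scale_left ip_scale_right mult.left_commute mult.assoc)
  also have "\<dots> = of_real ((norm c * norm x)\<^sup>2)"
    by (simp only: conj_of_mult_self ip_self of_real_mult power_mult_distrib)
  finally have "of_real ((norm (scl c x))\<^sup>2) = (of_real ((norm c * norm x)\<^sup>2) :: 'k)" .
  then have "(norm (scl c x))\<^sup>2 = (norm c * norm x)\<^sup>2" by (simp only: of_real_eq_iff)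
  then show ?thesis by (simp add: power2_eq_iff_nonneg)
qed

lemma bounded_linear_scl: "bounded_linear (scl c)"
proof (rule bounded_linear_intro)
  show "scl c (r *\<^sub>R x) = r *\<^sub>R scl c x" for r x
    by (simp add: scale_of_real[symmetric] mult.commute)
  show "norm (scl c x) \<le> norm x * norm c" for x
    by (simp add: norm_scl mult.commute)
qed (rule scale_right_distrib)

lemma subspace_imp_real_subspace:
  assumes "subspace W" shows "Real_Vector_Spaces.subspace W"
  using assms unfolding subspace_def real_vector.subspace_def by (metis scale_of_real)

text \<open>
  Rescaling \<open>w\<close> by the scalar \<open>ip w v\<close> makes the inner product real, so on a subspace
  orthogonality is already detected by the real part.
\<close>
lemma orthogonal_iff_inner:
  assumes "subspace W"
  shows "(\<forall>w\<in>W. ip w v = 0) \<longleftrightarrow> (\<forall>w\<in>W. inner w v = 0)"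
proof (intro iffI ballI)
  fix w assume "\<forall>w\<in>W. ip w v = 0" "w \<in> W"
  then show "inner w v = 0" using re_part_of_real[of 0] by (simp flip: re_part_ip)
next
  fix w assume *: "\<forall>w\<in>W. inner w v = 0" "w \<in> W"
  then have "scl (ip w v) w \<in> W" using assms by (simp add: subspace_scale)
  then have "re_part (ip (scl (ip w v) w) v) = 0" using * by (simp add: re_part_ip)
  then show "ip w v = 0" by (simp only: ip_scale_left conj_of_mult_self re_part_of_real) simp
qed

lemma ortho_compl_iff_inner:
  assumes "subspace W"
  shows "v \<in> ortho_compl ip UNIV W \<longleftrightarrow> (\<forall>w\<in>W. inner w v = 0)"
  using orthogonal_iff_inner[OF assms] by (simp add: ortho_compl_def)

lemma closed_ortho_compl:
  assumes "subspace W" shows "closed (ortho_compl ip UNIV W)"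
proof -
  have "ortho_compl ip UNIV W = (\<Inter>w\<in>W. {v. inner w v = 0})"
    using ortho_compl_iff_inner[OF assms] by auto
  then show ?thesis by (auto intro!: closed_INT closed_Collect_eq continuous_intros)
qed

lemma ortho_proj_eqI:
  assumes "subspace W" "p \<in> W" "\<forall>w\<in>W. inner w (v - p) = 0"
  shows "ortho_proj ip W v = p"
  unfolding ortho_proj_def orthogonal_iff_inner[OF assms(1)]
proof (rule the_equality)
  fix q assume q: "q \<in> W \<and> (\<forall>w\<in>W. inner w (v - q) = 0)"
  then have "q - p \<in> W" using assms subspace_diff by blast
  then have "inner (q - p) (v - p) - inner (q - p) (v - q) = 0" using q assms(3) by auto
  then have "inner (q - p) (q - p) = 0" by (simp add: inner_diff_right)
  then show "q = p" by simp
qed (use assms in auto)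

lemma ortho_proj:
  assumes "subspace W" "closed W"
  shows "ortho_proj ip W v \<in> W" "w \<in> W \<Longrightarrow> inner w (ortho_proj ip W v) = inner w v"
proof -
  obtain p where p: "p \<in> W" "\<forall>w\<in>W. inner w (v - p) = 0"
    using hilbert_projection[OF subspace_imp_real_subspace[OF assms(1)] assms(2)] by blast
  then have "ortho_proj ip W v = p" by (rule ortho_proj_eqI[OF assms(1)])
  with p show "ortho_proj ip W v \<in> W" "w \<in> W \<Longrightarrow> inner w (ortho_proj ip W v) = inner w v"
    by (auto simp: inner_diff_right)
qed

lemma norm_ortho_proj_le:
  assumes "subspace W" "closed W"
  shows "norm (ortho_proj ip W v) \<le> norm v"
proof -
  let ?p = "ortho_proj ip W v"
  have "norm ?p * norm ?p = inner ?p v"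
    using ortho_proj(2)[OF assms ortho_proj(1)[OF assms], of v v]
    by (simp add: dot_square_norm power2_eq_square)
  also have "\<dots> \<le> norm ?p * norm v" by (rule norm_cauchy_schwarz)
  finally show ?thesis by (cases "?p = 0") auto
qed

lemma subspace_closure:
  assumes "subspace W" shows "subspace (closure W)"
proof (rule subspaceI)
  have "W \<subseteq> closure W" by (rule closure_subset)
  then show "0 \<in> closure W" using assms subspace_0 by blast
  fix x assume "x \<in> closure W"
  then obtain u where u: "\<And>n. u n \<in> W" "u \<longlonglongrightarrow> x" unfolding closure_sequential by blast
  show "x + y \<in> closure W" if "y \<in> closure W" for y
  proof -
    obtain v where v: "\<And>n. v n \<in> W" "v \<longlonglongrightarrow> y"
      using \<open>y \<in> closure W\<close> unfolding closure_sequential by blast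
    have "(\<lambda>n. u n + v n) \<longlonglongrightarrow> x + y" by (intro tendsto_add u v)
    moreover have "u n + v n \<in> W" for n by (intro subspace_add assms u v)
    ultimately show ?thesis
      unfolding closure_sequential by (intro exI[of _ "\<lambda>n. u n + v n"]) simp
  qed
  show "scl c x \<in> closure W" for c
  proof -
    have "(\<lambda>n. scl c (u n)) \<longlonglongrightarrow> scl c x"
      by (rule bounded_linear.tendsto[OF bounded_linear_scl u(2)])
    moreover have "scl c (u n) \<in> W" for n by (intro subspace_scale assms u)
    ultimately show ?thesis
      unfolding closure_sequential by (intro exI[of _ "\<lambda>n. scl c (u n)"]) simp
  qed
qed

end

section \<open>Orbits of a contraction semigroup\<close>

locale contraction_semigroup = hilbert_space scl ip
  for scl :: "'k::real_or_complex \<Rightarrow> 'h::{real_inner, complete_space} \<Rightarrow> 'h"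
    and ip :: "'h \<Rightarrow> 'h \<Rightarrow> 'k" +
  fixes P :: "real \<Rightarrow> 'h \<Rightarrow> 'h"
  assumes semigroup: "contraction_C0_semigroup scl UNIV P"
begin

lemma P_add: "0 \<le> t \<Longrightarrow> P t (x + y) = P t x + P t y"
  and P_scl: "0 \<le> t \<Longrightarrow> P t (scl c x) = scl c (P t x)"
  and P_0: "P 0 x = x"
  and P_plus: "0 \<le> s \<Longrightarrow> 0 \<le> t \<Longrightarrow> P (s + t) x = P s (P t x)"
  and P_tendsto: "((\<lambda>t. P t x) \<longlongrightarrow> x) (at_right 0)"
  and norm_P_le: "0 \<le> t \<Longrightarrow> norm (P t x) \<le> norm x"
  using semigroup by (auto simp: contraction_C0_semigroup_def bounded_op_on_def)

lemma P_scaleR: "0 \<le> t \<Longrightarrow> P t (r *\<^sub>R x) = r *\<^sub>R P t x"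
  using P_scl[of t "of_real r"] by (simp add: scale_of_real)

lemma P_diff: "0 \<le> t \<Longrightarrow> P t (x - y) = P t x - P t y"
  using P_add[of t x "- 1 *\<^sub>R y"] P_scaleR[of t "-1" y] by simp

lemma tendsto_generator:
  assumes "x \<in> gen_dom UNIV P"
  shows "((\<lambda>t. (P t x - x) /\<^sub>R t) \<longlongrightarrow> generator P x) (at_right 0)"
proof -
  obtain y where y: "((\<lambda>t. (P t x - x) /\<^sub>R t) \<longlongrightarrow> y) (at_right 0)"
    using assms by (auto simp: gen_dom_def)
  then have "generator P x = y" unfolding generator_def by (intro tendsto_Lim) auto
  with y show ?thesis by simp
qed

lemma generatorI:
  assumes "((\<lambda>t. (P t x - x) /\<^sub>R t) \<longlongrightarrow> y) (at_right 0)"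
  shows "x \<in> gen_dom UNIV P" "generator P x = y"
  using assms unfolding generator_def by (auto simp: gen_dom_def intro!: tendsto_Lim)

lemma generator_add:
  assumes "x \<in> gen_dom UNIV P" "y \<in> gen_dom UNIV P"
  shows "x + y \<in> gen_dom UNIV P" "generator P (x + y) = generator P x + generator P y"
proof -
  have "((\<lambda>t. (P t (x + y) - (x + y)) /\<^sub>R t) \<longlongrightarrow> generator P x + generator P y) (at_right 0)"
  proof (rule Lim_transform_eventually[OF tendsto_add])
    show "\<forall>\<^sub>F t in at_right 0. (P t x - x) /\<^sub>R t + (P t y - y) /\<^sub>R t = (P t (x + y) - (x + y)) /\<^sub>R t"
      by (rule eventually_at_rightI[of _ 1]) (auto simp: P_add algebra_simps)
  qed (intro tendsto_generator assms)+
  from generatorI[OF this] show "x + y \<in> gen_dom UNIV P"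
    "generator P (x + y) = generator P x + generator P y" .
qed

lemma generator_scl:
  assumes "x \<in> gen_dom UNIV P"
  shows "scl c x \<in> gen_dom UNIV P" "generator P (scl c x) = scl c (generator P x)"
proof -
  interpret c: bounded_linear "scl c" by (rule bounded_linear_scl)
  have "((\<lambda>t. (P t (scl c x) - scl c x) /\<^sub>R t) \<longlongrightarrow> scl c (generator P x)) (at_right 0)"
  proof (rule Lim_transform_eventually[OF c.tendsto])
    show "\<forall>\<^sub>F t in at_right 0. scl c ((P t x - x) /\<^sub>R t) = (P t (scl c x) - scl c x) /\<^sub>R t"
      by (rule eventually_at_rightI[of _ 1]) (auto simp: P_scl c.scaleR c.diff)
  qed (rule tendsto_generator[OF assms])
  from generatorI[OF this] show "scl c x \<in> gen_dom UNIV P"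
    "generator P (scl c x) = scl c (generator P x)" .
qed

lemma generator_0: "0 \<in> gen_dom UNIV P" "generator P 0 = 0"
proof -
  have "P t 0 = 0" if "0 \<le> t" for t using P_scaleR[OF that, of 0 0] by simp
  then have "((\<lambda>t. (P t 0 - 0) /\<^sub>R t) \<longlongrightarrow> 0) (at_right 0)"
    by (intro tendsto_eventually eventually_at_rightI[of _ 1]) auto
  from generatorI[OF this] show "0 \<in> gen_dom UNIV P" "generator P 0 = 0" .
qed

lemma subspace_generator_image:
  assumes "subspace V" shows "subspace (generator P ` (gen_dom UNIV P \<inter> V))"
proof (rule subspaceI)
  show "0 \<in> generator P ` (gen_dom UNIV P \<inter> V)"
    using generator_0 subspace_0[OF assms] by force
  fix u assume "u \<in> generator P ` (gen_dom UNIV P \<inter> V)"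
  then obtain x where x: "x \<in> gen_dom UNIV P" "x \<in> V" "u = generator P x" by blast
  show "u + v \<in> generator P ` (gen_dom UNIV P \<inter> V)"
    if v: "v \<in> generator P ` (gen_dom UNIV P \<inter> V)" for v
  proof -
    obtain y where y: "y \<in> gen_dom UNIV P" "y \<in> V" "v = generator P y" using v by blast
    show ?thesis
      unfolding x(3) y(3) generator_add(2)[OF x(1) y(1), symmetric]
      by (intro imageI IntI generator_add(1) x y subspace_add assms)
  qed
  show "scl c u \<in> generator P ` (gen_dom UNIV P \<inter> V)" for c
    unfolding x(3) generator_scl(2)[OF x(1), symmetric]
    by (intro imageI IntI generator_scl(1) x subspace_scale assms)
qed

text \<open>
  The generator is defined by derivatives from the right at time 0. For \<open>u\<close> on either side of
  \<open>t\<close>, put \<open>a = min u t\<close> and \<open>h = \<bar>u - t\<bar>\<close>: the difference quotient of the orbit is \<open>P a\<close> applied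
  to the difference quotient at time 0 with step \<open>h\<close>. As \<open>P a\<close> is a contraction, the
  distance to \<open>P t (generator P x)\<close> is at most \<open>err h\<close>, which does not involve \<open>a\<close>.
\<close>
lemma orbit_has_vector_derivative:
  assumes x: "x \<in> gen_dom UNIV P" and t: "0 \<le> t"
  shows "((\<lambda>t. P t x) has_vector_derivative P t (generator P x)) (at t within {0..})"
proof -
  let ?y = "generator P x"
  define D where "D h = (P h x - x) /\<^sub>R h" for h
  define err where "err h = norm (D h - ?y) + norm (P h ?y - ?y)" for h
  have "(err \<longlongrightarrow> norm (?y - ?y) + norm (?y - ?y)) (at_right 0)"
    unfolding err_def D_def by (intro tendsto_intros tendsto_generator[OF x] P_tendsto)
  then have err0: "(err \<longlongrightarrow> 0) (at_right 0)" by simp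
  have "filterlim (\<lambda>u. \<bar>u - t\<bar>) (at_right 0) (at t within {0..})"
    unfolding filterlim_at
    by (intro conjI)
      (auto simp: eventually_at_filter intro!: tendsto_eq_intros always_eventually)
  from filterlim_compose[OF err0 this]
  have lim: "((\<lambda>u. err \<bar>u - t\<bar>) \<longlongrightarrow> 0) (at t within {0..})" .
  have est: "norm (P u x - P t x - (u - t) *\<^sub>R P t ?y) / norm (u - t) \<le> err \<bar>u - t\<bar>"
    if u: "0 \<le> u" "u \<noteq> t" for u
  proof -
    define a where "a = min u t"
    define h where "h = \<bar>u - t\<bar>"
    have ah: "0 \<le> a" "0 < h" using u t by (auto simp: a_def h_def)
    have Ph: "P h x - x = h *\<^sub>R D h" using ah by (simp add: D_def)
    have step: "P (a + h) x - P a x = h *\<^sub>R P a (D h)"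
      using ah by (simp add: P_plus flip: P_diff P_scaleR Ph)
    have quot: "P u x - P t x = (u - t) *\<^sub>R P a (D h)"
    proof (cases "t < u")
      case False
      then have "a + h = t" "a = u" "u - t = - h" by (auto simp: a_def h_def)
      with step show ?thesis by (metis minus_diff_eq scaleR_minus_left)
    qed (use step in \<open>simp add: a_def h_def\<close>)
    have "norm (P a (D h) - P t ?y) \<le> norm (P a (D h) - P a ?y) + norm (P a ?y - P t ?y)"
      using norm_triangle_ineq[of "P a (D h) - P a ?y" "P a ?y - P t ?y"] by simp
    also have "norm (P a (D h) - P a ?y) \<le> norm (D h - ?y)"
      using ah norm_P_le by (simp flip: P_diff)
    also have "norm (P a ?y - P t ?y) \<le> norm (P h ?y - ?y)"
    proof (cases "t < u")
      case False
      then have "t = a + h" by (auto simp: a_def h_def)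
      then have "P t ?y - P a ?y = P a (P h ?y - ?y)" using ah by (simp add: P_plus P_diff)
      then show ?thesis using norm_P_le[OF ah(1)] by (metis norm_minus_commute)
    qed (simp add: a_def)
    finally have "norm (P a (D h) - P t ?y) \<le> err h" by (simp add: err_def)
    moreover have "P u x - P t x - (u - t) *\<^sub>R P t ?y = (u - t) *\<^sub>R (P a (D h) - P t ?y)"
      by (simp add: quot algebra_simps)
    ultimately show ?thesis using u by (simp add: h_def)
  qed
  have "((\<lambda>u. norm (P u x - P t x - (u - t) *\<^sub>R P t ?y) / norm (u - t)) \<longlongrightarrow> 0) (at t within {0..})"
  proof (rule tendsto_sandwich[OF _ _ tendsto_const lim])
    show "\<forall>\<^sub>F u in at t within {0..}. norm (P u x - P t x - (u - t) *\<^sub>R P t ?y) / norm (u - t)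
        \<le> err \<bar>u - t\<bar>"
      using est by (auto simp: eventually_at_filter intro!: always_eventually)
  qed (auto intro!: always_eventually)
  then show ?thesis
    unfolding has_vector_derivative_def has_derivative_iff_norm by (simp add: bounded_linear_scaleR_left)
qed

text \<open>
  The mean value inequality stands in for the bound on the integral of \<open>P t (generator P x)\<close>.
\<close>
lemma orbit_increment_le:
  assumes x: "x \<in> gen_dom UNIV P" and "0 \<le> a" "a \<le> b"
    and cont: "continuous_on {a..b} \<phi>"
    and deriv: "\<And>t. a < t \<Longrightarrow> t < b \<Longrightarrow> (\<phi> has_vector_derivative \<phi>' t) (at t)"
    and bound: "\<And>t. a < t \<Longrightarrow> t < b \<Longrightarrow> norm (P t (generator P x)) \<le> \<phi>' t"
  shows "norm (P b x - P a x) \<le> \<phi> b - \<phi> a"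
proof (cases "a = b")
  case False
  show ?thesis
  proof (rule differentiable_bound_general)
    show "continuous_on {a..b} (\<lambda>t. P t x)"
      unfolding continuous_on_eq_continuous_within
    proof
      fix t assume "t \<in> {a..b}"
      then have "0 \<le> t" and "{a..b} \<subseteq> {0..}" using \<open>0 \<le> a\<close> by auto
      then show "continuous (at t within {a..b}) (\<lambda>t. P t x)"
        using has_vector_derivative_continuous[OF orbit_has_vector_derivative[OF x]]
          continuous_within_subset by blast
    qed
    show "((\<lambda>t. P t x) has_vector_derivative P t (generator P x)) (at t)" if "a < t" for t
      using orbit_has_vector_derivative[OF x, of t] that \<open>0 \<le> a\<close>
        at_within_interior[of t "{0..}"] by simp
  qed (use False assms in auto)
qed simp

lemma P_equilibrium:
  assumes "x \<in> gen_ker UNIV P" "0 \<le> t"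
  shows "P t x = x"
proof -
  have x: "x \<in> gen_dom UNIV P" and "generator P x = 0" using assms(1) by (auto simp: gen_ker_def)
  then have "norm (P s (generator P x)) \<le> 0" if "0 < s" for s
    using norm_P_le[of s 0] that by simp
  then have "norm (P t x - P 0 x) \<le> 0 - 0"
    by (intro orbit_increment_le[OF x, where \<phi>' = "\<lambda>_. 0"]) (auto simp: assms(2))
  then show ?thesis by (simp add: P_0)
qed

text \<open>
  A contraction and its adjoint have the same fixed vectors. Expanding
  \<open>norm (P t (r *\<^sub>R w + x)) \<le> norm (r *\<^sub>R w + x)\<close> at a fixed \<open>w\<close>, the terms quadratic in \<open>r\<close>
  cancel, so the coefficient of \<open>r\<close> has to vanish.
\<close>
lemma inner_equilibrium_P:
  assumes w: "w \<in> gen_ker UNIV P" and t: "0 \<le> t"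
  shows "inner w (P t x) = inner w x"
proof (rule ccontr)
  assume "inner w (P t x) \<noteq> inner w x"
  define d where "d = inner w (P t x) - inner w x"
  have d: "d \<noteq> 0" using \<open>inner w (P t x) \<noteq> inner w x\<close> by (simp add: d_def)
  have key: "2 * (r * d) \<le> (norm x)\<^sup>2" for r
  proof -
    have "(norm (P t (r *\<^sub>R w + x)))\<^sup>2 \<le> (norm (r *\<^sub>R w + x))\<^sup>2"
      using norm_P_le[OF t] by (simp add: power_mono)
    moreover have "P t (r *\<^sub>R w + x) = r *\<^sub>R w + P t x"
      using P_equilibrium[OF w t] t by (simp add: P_add P_scaleR)
    ultimately have "2 * (r * d) + (norm (P t x))\<^sup>2 \<le> (norm x)\<^sup>2"
      unfolding d_def power2_norm_eq_inner
      by (simp add: inner_add_left inner_add_right inner_commute algebra_simps)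
    then show ?thesis using zero_le_power2[of "norm (P t x)"] by linarith
  qed
  \<comment> \<open>An \<open>r\<close> for which the left-hand side of \<open>key\<close> exceeds the right.\<close>
  have "2 * (((norm x)\<^sup>2 + 1) / d * d) \<le> (norm x)\<^sup>2" by (rule key)
  then have "(norm x)\<^sup>2 + 2 \<le> 0" using d by simp
  then show False using zero_le_power2[of "norm x"] by linarith
qed

lemma inner_equilibrium_generator:
  assumes w: "w \<in> gen_ker UNIV P" and x: "x \<in> gen_dom UNIV P"
  shows "inner w (generator P x) = 0"
proof (rule tendsto_unique[of "at_right (0::real)"])
  show "((\<lambda>t. inner w ((P t x - x) /\<^sub>R t)) \<longlongrightarrow> inner w (generator P x)) (at_right 0)"
    by (intro tendsto_intros tendsto_generator[OF x])
  show "((\<lambda>t. inner w ((P t x - x) /\<^sub>R t)) \<longlongrightarrow> 0) (at_right 0)"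
    by (intro tendsto_eventually eventually_at_rightI[of _ 1])
      (auto simp: inner_diff_right inner_equilibrium_P[OF w])
qed simp

section \<open>Consequences of hypocoercivity\<close>

context
  fixes C \<nu> :: real
  assumes hypo: "hypocoercive ip P C \<nu>"
begin

abbreviation "Q \<equiv> equilibrium_proj ip P"

lemma C_gt_1: "1 < C" and rate_pos: "0 < \<nu>"
  and decay: "0 \<le> t \<Longrightarrow> norm (P t x - Q x) \<le> C * exp (- \<nu> * t) * norm (x - Q x)"
  using hypo by (auto simp: hypocoercive_def)

text \<open>
  \<open>Q\<close> is defined by a description. Its properties are read off from its being the limit of
  \<open>P t\<close> as \<open>t \<longlongrightarrow> \<infinity>\<close>, which the decay estimate gives.
\<close>
lemma P_tendsto_equilibrium: "((\<lambda>t. P t x) \<longlongrightarrow> Q x) at_top"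
proof -
  have "filterlim (\<lambda>t. \<nu> * t) at_top at_top"
    by (rule filterlim_tendsto_pos_mult_at_top[OF tendsto_const rate_pos filterlim_ident])
  then have "((\<lambda>t. exp (- (\<nu> * t))) \<longlongrightarrow> 0) at_top"
    by (intro filterlim_compose[OF exp_at_bot]) (simp add: filterlim_uminus_at_bot)
  then have "((\<lambda>t. C * exp (- \<nu> * t) * norm (x - Q x)) \<longlongrightarrow> C * 0 * norm (x - Q x)) at_top"
    by (intro tendsto_intros) simp
  then have lim: "((\<lambda>t. C * exp (- \<nu> * t) * norm (x - Q x)) \<longlongrightarrow> 0) at_top" by simp
  have "((\<lambda>t. P t x - Q x) \<longlongrightarrow> 0) at_top"
    by (rule Lim_null_comparison[OF eventually_at_top_linorderI[of 0] lim]) (rule decay)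
  then show ?thesis by (simp add: LIM_zero_iff)
qed

lemma equilibrium_proj_in_kernel: "Q x \<in> gen_ker UNIV P"
proof -
  have fixed: "P s (Q x) = Q x" if s: "0 \<le> s" for s
  proof (rule tendsto_unique[of "at_top :: real filter"])
    have "((\<lambda>t. P t x - Q x) \<longlongrightarrow> 0) at_top" using P_tendsto_equilibrium by (simp add: LIM_zero_iff)
    then have "((\<lambda>t. P s (P t x) - P s (Q x)) \<longlongrightarrow> 0) at_top"
      by (rule tendsto_0_le[where K = 1]) (auto simp: norm_P_le[OF s] simp flip: P_diff[OF s])
    then show "((\<lambda>t. P s (P t x)) \<longlongrightarrow> P s (Q x)) at_top" by (simp add: LIM_zero_iff)
    have "((\<lambda>t. P (s + t) x) \<longlongrightarrow> Q x) at_top"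
      by (rule filterlim_compose[OF P_tendsto_equilibrium])
        (rule filterlim_tendsto_add_at_top[OF tendsto_const filterlim_ident])
    then show "((\<lambda>t. P s (P t x)) \<longlongrightarrow> Q x) at_top"
      by (rule Lim_transform_eventually)
        (auto intro!: eventually_at_top_linorderI[of 0] P_plus s)
  qed simp
  have "((\<lambda>t. (P t (Q x) - Q x) /\<^sub>R t) \<longlongrightarrow> 0) (at_right 0)"
    by (intro tendsto_eventually eventually_at_rightI[of _ 1]) (auto simp: fixed)
  from generatorI[OF this] show ?thesis by (simp add: gen_ker_def)
qed

lemma inner_equilibrium_proj:
  assumes "w \<in> gen_ker UNIV P"
  shows "inner w (Q x) = inner w x"
proof (rule tendsto_unique[of "at_top :: real filter"])
  show "((\<lambda>t. inner w (P t x)) \<longlongrightarrow> inner w (Q x)) at_top"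
    by (intro tendsto_intros P_tendsto_equilibrium)
  show "((\<lambda>t. inner w (P t x)) \<longlongrightarrow> inner w x) at_top"
    by (intro tendsto_eventually eventually_at_top_linorderI[of 0])
      (simp add: inner_equilibrium_P[OF assms])
qed simp

lemma equilibrium_proj_eq_0:
  assumes "inner (Q x) x = 0"
  shows "Q x = 0"
  using inner_equilibrium_proj[OF equilibrium_proj_in_kernel[of x], of x] assms by simp

lemma equilibrium_proj_generator:
  assumes "x \<in> gen_dom UNIV P"
  shows "Q (generator P x) = 0"
  by (intro equilibrium_proj_eq_0 inner_equilibrium_generator equilibrium_proj_in_kernel assms)

text \<open>
  The two decay rates \<open>1\<close> and \<open>C * exp (- \<nu> * t)\<close> for \<open>P t (generator P x)\<close> cross at
  \<open>T = ln C / \<nu>\<close>. The orbit moves by at most \<open>T * norm (generator P x)\<close> before \<open>T\<close> and by at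
  most \<open>norm (generator P x) / \<nu>\<close> after it, and it ends at \<open>Q x = 0\<close>.
\<close>
lemma norm_le_norm_generator:
  assumes x: "x \<in> gen_dom UNIV P" and Qx: "Q x = 0"
  shows "\<nu> * norm x \<le> (1 + ln C) * norm (generator P x)"
proof -
  let ?y = "generator P x"
  define T where "T = ln C / \<nu>"
  have T: "0 \<le> T" using C_gt_1 rate_pos by (simp add: T_def)
  have "\<nu> * T = ln C" using rate_pos by (simp add: T_def)
  then have CT: "C * exp (- \<nu> * T) = 1" using C_gt_1 by (simp add: exp_minus)
  have early: "norm (P T x - P 0 x) \<le> norm ?y * T - norm ?y * 0"
  proof (rule orbit_increment_le[OF x _ T])
    show "((\<lambda>t. norm ?y * t) has_vector_derivative norm ?y) (at t)" for t
      by (auto intro!: derivative_eq_intros simp flip: has_real_derivative_iff_has_vector_derivative)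
  qed (auto intro!: continuous_intros norm_P_le)
  have late: "norm (P t x - P T x) \<le> norm ?y / \<nu>" if "T \<le> t" for t
  proof -
    let ?\<phi> = "\<lambda>t. - (C * exp (- \<nu> * t) * norm ?y / \<nu>)"
    have "norm (P t x - P T x) \<le> ?\<phi> t - ?\<phi> T"
    proof (rule orbit_increment_le[OF x T that])
      show "(?\<phi> has_vector_derivative C * exp (- \<nu> * s) * norm ?y) (at s)" for s
        using rate_pos
        by (auto intro!: derivative_eq_intros simp flip: has_real_derivative_iff_has_vector_derivative)
      show "norm (P s ?y) \<le> C * exp (- \<nu> * s) * norm ?y" if "T < s" for s
        using decay[of s ?y] that T by (simp add: equilibrium_proj_generator[OF x])
    qed (use rate_pos in \<open>auto intro!: continuous_intros\<close>)
    also have "\<dots> \<le> - ?\<phi> T" using C_gt_1 rate_pos by simp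
    also have "\<dots> = norm ?y / \<nu>" by (simp only: CT minus_minus mult_1)
    finally show ?thesis .
  qed
  have "norm x \<le> norm (P t x) + (norm ?y / \<nu> + norm ?y * T)" if "T \<le> t" for t
  proof -
    have "norm x \<le> norm (P t x) + norm (P t x - P T x) + norm (P T x - P 0 x)"
      unfolding P_0 by norm
    with early late[OF that] show ?thesis by simp
  qed
  then have "\<forall>\<^sub>F t in at_top. norm x \<le> norm (P t x) + (norm ?y / \<nu> + norm ?y * T)"
    by (rule eventually_at_top_linorderI)
  moreover have "((\<lambda>t. norm (P t x) + (norm ?y / \<nu> + norm ?y * T)) \<longlongrightarrow>
      norm (0::'h) + (norm ?y / \<nu> + norm ?y * T)) at_top"
    using P_tendsto_equilibrium[of x] unfolding Qx by (intro tendsto_intros)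
  ultimately have "norm x \<le> norm (0::'h) + (norm ?y / \<nu> + norm ?y * T)"
    by (intro tendsto_lowerbound[where F = "at_top :: real filter"]) simp_all
  then show ?thesis using rate_pos by (simp add: T_def field_simps)
qed

end

end

section \<open>The lift constant and the upper bound on the rate\<close>

text \<open>
  The coercivity of symmetric operators bounded below applies to the compression \<open>A\<close> of \<open>S\<close> to
  the closed subspace \<open>R\<close>, where the forms of \<open>A\<close> and \<open>S\<close> agree.
\<close>
lemma (in contraction_semigroup) lift_const_le_form:
  assumes HO: "subspace HO" and lift: "second_order_lift scl ip HO P PO S"
    and x: "x \<in> gen_dom UNIV P \<inter> HO"
  shows "lift_const ip HO P S * (norm (generator P x))\<^sup>2
    \<le> inner (generator P x) (S (generator P x))"
proof -
  define R where "R = ran_closure HO P"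
  define A where "A y = ortho_proj ip R (S y)" for y
  let ?N = "ortho_compl ip UNIV HO"
  have R: "subspace R" "closed R"
    unfolding R_def ran_closure_def
    by (auto intro: subspace_closure subspace_generator_image[OF HO])
  have "generator P ` (gen_dom UNIV P \<inter> HO) \<subseteq> ?N"
    using lift by (auto simp: second_order_lift_def ortho_compl_def)
  then have RN: "y \<in> ?N" if "y \<in> R" for y
    using that closure_minimal[OF _ closed_ortho_compl[OF HO]] by (auto simp: R_def ran_closure_def)
  obtain M where M: "\<And>y. y \<in> ?N \<Longrightarrow> norm (S y) \<le> M * norm y"
    using lift unfolding second_order_lift_def bounded_op_on_def by blast
  have S_sym: "inner (S y) z = inner y (S z)" and S_pos: "0 \<le> inner y (S y)"
    if "y \<in> R" "z \<in> R" for y z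
    using lift RN[OF that(1)] RN[OF that(2)]
    by (auto simp: second_order_lift_def positive_op_on_def simp flip: re_part_ip)
  have A: "inner z (A y) = inner z (S y)" if "z \<in> R" for y z
    unfolding A_def by (rule ortho_proj(2)[OF R that])
  have y: "generator P x \<in> R"
    unfolding R_def ran_closure_def using x by (intro subsetD[OF closure_subset] imageI)
  have "lift_const ip HO P S * (norm (generator P x))\<^sup>2 \<le> inner (generator P x) (A (generator P x))"
  proof (rule symmetric_bounded_below_imp_coercive[OF subspace_imp_real_subspace[OF R(1)] _ _ _ _ _ y])
    show "A y \<in> R" for y unfolding A_def by (rule ortho_proj(1)[OF R])
    show "inner (A y) z = inner y (A z)" if "y \<in> R" "z \<in> R" for y z
      using that S_sym by (simp add: A inner_commute[of "A y"]) (simp add: inner_commute)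
    show "0 \<le> inner y (A y)" if "y \<in> R" for y using that S_pos by (simp add: A)
    show "norm (A y) \<le> M * norm y" if "y \<in> R" for y
      using norm_ortho_proj_le[OF R, of "S y"] M[OF RN[OF that]] by (simp add: A_def)
    show "lift_const ip HO P S * norm y \<le> norm (A y)" if "y \<in> R" for y
    proof (cases "y = 0")
      case False
      have "ortho_proj ip R y = y" by (rule ortho_proj_eqI[OF R(1) that]) simp
      moreover have "lift_const ip HO P S
          \<le> norm (ortho_proj ip R (S (ortho_proj ip R y))) / norm y"
        unfolding lift_const_def R_def[symmetric]
        using that False by (intro cINF_lower bdd_belowI[of _ 0]) auto
      ultimately have "lift_const ip HO P S \<le> norm (A y) / norm y" by (simp add: A_def)
      then show ?thesis using False by (simp add: pos_le_divide_eq)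
    qed simp
  qed
  then show ?thesis by (simp add: A[OF y])
qed

text \<open>
  For an equilibrium \<open>f\<close> of \<open>P\<close> in \<open>HO\<close>, the left-hand side of the lift identity vanishes, so
  \<open>f\<close> annihilates the range of the generator of \<open>PO\<close>. By self-adjointness, \<open>f\<close> is then
  in the domain and in the kernel of that generator, hence orthogonal to \<open>x\<close>. For \<open>f = Q x\<close>,
  orthogonality to \<open>x\<close> forces \<open>f = 0\<close>.
\<close>
lemma (in contraction_semigroup) equilibrium_proj_eq_0_of_lift:
  assumes hypo: "hypocoercive ip P C \<nu>"
    and sa: "self_adjoint_on ip HO (gen_dom HO PO) (generator PO)"
    and lift: "second_order_lift scl ip HO P PO S"
    and compat: "equilibrium_compatible ip HO P"
    and HO: "subspace HO"
    and x: "x \<in> ortho_compl ip HO (gen_ker HO PO)"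
  shows "equilibrium_proj ip P x = 0"
proof -
  define f where "f = equilibrium_proj ip P x"
  have ker: "f \<in> gen_ker UNIV P" unfolding f_def by (rule equilibrium_proj_in_kernel[OF hypo])
  have fHO: "f \<in> HO"
    using x compat by (auto simp: f_def equilibrium_compatible_def ortho_compl_def)
  have ip_0: "ip 0 z = 0" "ip z 0 = 0" for z
    using ip_scale_left[of 0 0 z] ip_scale_right[of z 0 0] by (simp_all add: conj_of_zero)
  have "ip (generator PO y) f = ip y 0" if "y \<in> gen_dom HO PO" for y
  proof -
    have "ip (generator P f) (S (generator P y)) = - ip f (generator PO y)"
      using lift that ker fHO unfolding second_order_lift_def gen_ker_def by blast
    then have "ip f (generator PO y) = 0" using ker by (simp add: gen_ker_def ip_0)
    then show ?thesis using ip_commute[of "generator PO y" f] by (simp add: ip_0 conj_of_zero)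
  qed
  then have "(f, 0) \<in> adjoint_graph ip HO (gen_dom HO PO) (generator PO)"
    using fHO subspace_0[OF HO] by (auto simp: adjoint_graph_def)
  then have "f \<in> gen_ker HO PO" using sa by (auto simp: self_adjoint_on_def gen_ker_def)
  then have "ip f x = 0" using x by (auto simp: ortho_compl_def)
  then have "inner f x = 0" using re_part_of_real[of 0] by (simp flip: re_part_ip)
  then show ?thesis unfolding f_def by (rule equilibrium_proj_eq_0[OF hypo])
qed

theorem theorem3p6:
  fixes scl :: "'k::real_or_complex \<Rightarrow> 'h::{real_inner, complete_space} \<Rightarrow> 'h"
    and ip :: "'h \<Rightarrow> 'h \<Rightarrow> 'k"
    and HO :: "'h set"
    and P PO :: "real \<Rightarrow> 'h \<Rightarrow> 'h"
    and S :: "'h \<Rightarrow> 'h"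
    and C \<nu> lamO :: real
  assumes "hilbert_space scl ip"
    and "module.subspace scl HO" and "closed HO" and "HO \<noteq> UNIV"
    and "contraction_C0_semigroup scl UNIV P"
    and "hypocoercive ip P C \<nu>"
    and "contraction_C0_semigroup scl HO PO"
    and "symmetric_semigroup ip HO PO"
    and "coercive_semigroup ip HO PO lamO"
    and "purely_discrete_spectrum scl HO (gen_dom HO PO) (generator PO)"
    and "second_order_lift scl ip HO P PO S"
    and "equilibrium_compatible ip HO P"
    and "lift_const ip HO P S > 0"
  shows "\<nu> \<le> (1 + ln C) * sqrt (inverse (lift_const ip HO P S) * lamO)"
proof -
  interpret contraction_semigroup scl ip P
    using assms by (intro contraction_semigroup.intro contraction_semigroup_axioms.intro)
  note HO = \<open>module.subspace scl HO\<close> and hypo = \<open>hypocoercive ip P C \<nu>\<close>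
    and lift = \<open>second_order_lift scl ip HO P PO S\<close>
  define s where "s = lift_const ip HO P S"
  have s: "0 < s" using assms by (simp add: s_def)
  have C: "0 \<le> 1 + ln C" using C_gt_1[OF hypo] by (simp add: add_nonneg_nonneg)
  \<comment> \<open>Any \<open>l\<close> above the gap exceeds the Dirichlet form of some admissible unit vector.\<close>
  have near: "\<nu> \<le> (1 + ln C) * sqrt (inverse s * l)" if l: "lamO < l" for l
  proof -
    have "(INF x\<in>{x \<in> gen_dom HO PO \<inter> ortho_compl ip HO (gen_ker HO PO). norm x = 1}.
        ereal (- re_part (ip x (generator PO x)))) < ereal l"
      using assms(9) l unfolding coercive_semigroup_def by (metis ereal_less_eq(3) linorder_not_le)
    then obtain x where x: "x \<in> gen_dom HO PO" "x \<in> ortho_compl ip HO (gen_ker HO PO)" "norm x = 1"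
      and energy: "- re_part (ip x (generator PO x)) < l"
      by (auto simp: INF_less_iff)
    let ?y = "generator P x"
    have xL: "x \<in> gen_dom UNIV P \<inter> HO"
      using x lift by (auto simp: second_order_lift_def ortho_compl_def)
    have "ip ?y (S ?y) = - ip x (generator PO x)"
      using lift x(1) xL by (auto simp: second_order_lift_def)
    moreover have "ip x (- generator PO x) = - ip x (generator PO x)"
      using ip_scale_right[of x "-1" "generator PO x"] by simp
    ultimately have "inner ?y (S ?y) = - re_part (ip x (generator PO x))"
      by (metis re_part_ip inner_minus_right)
    with energy lift_const_le_form[OF HO lift xL]
    have "s * (norm ?y)\<^sup>2 \<le> l" by (simp add: s_def)
    then have "(norm ?y)\<^sup>2 \<le> inverse s * l" using s by (simp add: field_simps)
    then have y: "norm ?y \<le> sqrt (inverse s * l)" by (rule real_le_rsqrt)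
    have "equilibrium_proj ip P x = 0"
      using equilibrium_proj_eq_0_of_lift[OF hypo _ lift _ HO x(2)] assms
      by (simp add: coercive_semigroup_def)
    then have "\<nu> * norm x \<le> (1 + ln C) * norm ?y"
      using norm_le_norm_generator[OF hypo] xL by blast
    also have "\<dots> \<le> (1 + ln C) * sqrt (inverse s * l)" by (intro mult_left_mono y C)
    finally show ?thesis using x(3) by simp
  qed
  have "\<nu> \<le> (1 + ln C) * sqrt (inverse s * lamO)"
  proof (rule tendsto_lowerbound[where F = "at_right lamO"])
    show "((\<lambda>l. (1 + ln C) * sqrt (inverse s * l)) \<longlongrightarrow> (1 + ln C) * sqrt (inverse s * lamO)) (at_right lamO)"
      by (intro tendsto_intros)
    show "\<forall>\<^sub>F l in at_right lamO. \<nu> \<le> (1 + ln C) * sqrt (inverse s * l)"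
      by (rule eventually_at_rightI[of _ "lamO + 1"]) (auto intro: near)
  qed simp
  then show ?thesis by (simp add: s_def)
qed

end
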